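(* Let $W$ be a non-negative, integer-valued random variable with $\mathbb{E}[W]=\lambda>0$, let $Z_\lambda\sim\mathrm{Po}(\lambda)$, let $s\geq1$ be an integer, and suppose that $\mathbb{E}\binom{W}{k}\leq\mathbb{E}\binom{Z_\lambda}{k}$ for $k=3,\ldots,s$ (no condition if $s\le2$). Suppose also that $W^\star\leq_{s-cx}W+1$, where $W^\star$ has the $W$-size-biased distribution. If $W$ has distribution function $F$ and $Z_\lambda$ has distribution function $G_\lambda$, then $$d_{-k,\infty}(F,G_\lambda)\leq2^{(s-k-1)_+}\,\mathbb{E}\left[\binom{Z_\lambda+s+1}{s+1}-\binom{W+s+1}{s+1}\right]$$ for $k=-1,0,\ldots,s+1$.
   Context: $\mathbb{Z}^+=\{0,1,2,\ldots\}$; $(x)_+=\max(x,0)$; $\binom{a}{b}=0$ if $b>a$. $\mathrm{Po}(\lambda)$ is the Poisson distribution with mean $\lambda$. $W^\star$ has mass function $\mathbb{P}(W^\star=j)=j\,\mathbb{P}(W=j)/\lambda$, $j\in\mathbb{Z}^+$. Differences: $\Delta f(j)=f(j+1)-f(j)$, $\Delta^{-1}f(j)=-\sum_{i=j}^\infty f(i)$, $\Delta^0f=f$, $\Delta^nf=\Delta(\Delta^{n-1}f)$, $\Delta^{-n}f=\Delta^{-1}(\Delta^{-n+1}f)$ for $n\geq1$. $s$-convex order: $X\leq_{s-cx}Y$ means $\mathbb{E}f(X)\leq\mathbb{E}f(Y)$ for all $f:\mathbb{Z}^+\to\mathbb{R}$ with $\Delta^if(j)\geq0$ for all $j\in\mathbb{Z}^+$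 and $i=1,\ldots,s$. Distances: $d_{n,\infty}(F,G)=\lVert\Delta^nF-\Delta^nG\rVert_\infty$ for $n\in\mathbb{Z}$, where $\lVert f\rVert_\infty=\sup_{j\in\mathbb{Z}^+}|f(j)|$ and $\Delta^nF-\Delta^nG$ means $\Delta^n(F-G)$. *)

theory Defs
  imports "HOL-Probability.Probability"
begin

definition fdiff :: "(nat \<Rightarrow> real) \<Rightarrow> nat \<Rightarrow> real" where
  "fdiff f j = f (j + 1) - f j"

text \<open>\<open>inv_fdiff f j = - (f j + f (j + 1) + \<dots>)\<close>; meaningful only when \<open>f\<close> is summable.\<close>

definition inv_fdiff :: "(nat \<Rightarrow> real) \<Rightarrow> nat \<Rightarrow> real" where
  "inv_fdiff f j = - (\<Sum>i. f (j + i))"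

definition diff_pow :: "int \<Rightarrow> (nat \<Rightarrow> real) \<Rightarrow> nat \<Rightarrow> real" where
  "diff_pow n = (if n \<ge> 0 then fdiff ^^ nat n else inv_fdiff ^^ nat (- n))"

text \<open>Expectation in the extended reals. The order below uses it only for functions bounded
  below on a probability space, so \<open>\<infinity> - \<infinity>\<close> never occurs and the value is \<open>\<infinity>\<close> exactly when the
  function is not integrable. The Bochner integral would give \<open>0\<close> in that case.\<close>

definition ext_expectation :: "'a measure \<Rightarrow> ('a \<Rightarrow> real) \<Rightarrow> ereal" where
  "ext_expectation M f =
     enn2ereal (\<integral>\<^sup>+\<omega>. ennreal (f \<omega>) \<partial>M) - enn2ereal (\<integral>\<^sup>+\<omega>. ennreal (- f \<omega>) \<partial>M)"

text \<open>The \<open>s\<close>-convex order between \<open>X\<close> on \<open>M\<close> and \<open>Y\<close> on \<open>N\<close>. For \<open>s \<ge> 1\<close> every admissible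
  \<open>f\<close> is nondecreasing, hence bounded below by \<open>f 0\<close>.\<close>

definition s_cx_le ::
  "nat \<Rightarrow> 'a measure \<Rightarrow> ('a \<Rightarrow> nat) \<Rightarrow> 'b measure \<Rightarrow> ('b \<Rightarrow> nat) \<Rightarrow> bool" where
  "s_cx_le s M X N Y \<longleftrightarrow>
     (\<forall>f :: nat \<Rightarrow> real. (\<forall>i\<in>{1..s}. \<forall>j. diff_pow (int i) f j \<ge> 0) \<longrightarrow>
        ext_expectation M (\<lambda>\<omega>. f (X \<omega>)) \<le> ext_expectation N (\<lambda>\<omega>. f (Y \<omega>)))"

definition sup_norm :: "(nat \<Rightarrow> real) \<Rightarrow> ereal" where
  "sup_norm f = (SUP j. ereal \<bar>f j\<bar>)"

definition d_inf :: "int \<Rightarrow> (nat \<Rightarrow> real) \<Rightarrow> (nat \<Rightarrow> real) \<Rightarrow> ereal" where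
  "d_inf n F G = sup_norm (diff_pow n (\<lambda>j. F j - G j))"

end

theory Submission
  imports Defs
begin

text \<open>The upper tails \<open>P(W > j)\<close> and all their iterated sums are expectations of truncated binomial
polynomials \<open>((x - j - 1) + n) choose n\<close> for \<open>x > j\<close>, called splines here. Hence, up to sign,
\<open>\<Delta>\<^sup>-\<^sup>k (F - G) j\<close> is the difference between the expectations under \<open>W\<close> and under \<open>Z\<close> of a spline
with knot \<open>j\<close> (\<open>inv_fdiff_pow_spline_mean\<close>; for \<open>k = -1\<close> the spline is a point mass). The theorem is
therefore a comparison of expectations of explicit functions, and it follows once \<open>W\<close> is known to
be below \<open>Z\<close> in the \<open>(s + 1)\<close>-convex order.

That order relation is proved on the generators of the cone of admissible functions. By Newton's
forward difference formula (\<open>newton_expansion\<close>) these are the binomial coefficients of degree at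
most \<open>s\<close>, which the moment conditions handle (\<open>spline_mean_start_le\<close>), and the truncated polynomials of
degree \<open>s\<close>. For the latter, testing \<open>W* \<le> W + 1\<close> on the truncated polynomials of degree \<open>s - 1\<close> gives,
because multiplication by \<open>x\<close> is so simple on splines (\<open>times_spline\<close>), a second-order difference
inequality in the knot for the means \<open>t a = E ((W - a)\<^sub>+ choose s)\<close>:
\<open>(s + a + lam) * t a \<le> a * t (a + 1) + lam * t (a - 1)\<close> for \<open>a \<ge> 1\<close>. The Poisson law satisfies it with
equality, by the Stein identity. The Poisson sequence minus that of \<open>W\<close> is
nonnegative at \<open>a = 0\<close> and tends to \<open>0\<close>, so a minimum principle makes it nonnegative throughout
(\<open>spline_mean_le\<close>). Test functions of the same kind, with negative knots, show inductively that
\<open>W\<close> has all moments (\<open>spline_nn_integral_finite\<close>).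

For the distance itself, let \<open>P x = (x + s + 1) choose (s + 1)\<close>. The differences of \<open>P\<close> of orders up to
\<open>s + 1\<close> are at least \<open>1\<close> and majorise those of a spline of degree \<open>k\<close> and knot at least \<open>-1\<close> up to the
order \<open>k + 1\<close>, which is a point mass; further differences of that cost at most a factor \<open>2 ^ (s - k - 1)\<close>
(\<open>fdiff_pow_spline_le\<close>). So this multiple of \<open>P\<close>, plus or minus the spline, is admissible in the
\<open>(s + 1)\<close>-convex order, and the two comparisons together are the assertion (\<open>spline_mean_distance\<close>).\<close>

section \<open>Truncated binomial polynomials\<close>

text \<open>The discrete analogue of the truncated powers \<open>(x - j)\<^sub>+ ^ n / n!\<close>: order \<open>0\<close> is a point mass, and each
further order is obtained by summing over the knot. The knot \<open>j\<close> is an integer because differencing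
moves it to the left, possibly below \<open>0\<close>; a spline of positive order with a negative knot
is an ordinary polynomial on the naturals. The point mass with knot \<open>j\<close> sits at \<open>j + 1\<close>, so that
the recursion \<open>spline_pascal\<close> holds from order \<open>0\<close> on.\<close>

definition spline :: "nat \<Rightarrow> int \<Rightarrow> nat \<Rightarrow> real" where
  "spline r j x = (case r of
      0 \<Rightarrow> (if int x = j + 1 then 1 else 0)
    | Suc n \<Rightarrow> (if j < int x then real ((nat (int x - j - 1) + n) choose n) else 0))"

lemma spline_0: "spline 0 j x = (if int x = j + 1 then 1 else 0)"
  by (simp add: spline_def)

lemma spline_Suc:
  "spline (Suc n) j x = (if j < int x then real ((nat (int x - j - 1) + n) choose n) else 0)"
  by (simp add: spline_def)

lemma spline_1: "spline (Suc 0) j x = (if j < int x then 1 else 0)"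
  by (simp add: spline_Suc)

lemma spline_nonneg: "0 \<le> spline r j x"
  by (simp add: spline_def split: nat.split)

lemma spline_shift: "spline r j (Suc x) = spline r (j - 1) x"
  by (cases r) (auto simp: spline_0 spline_Suc algebra_simps)

lemma binomial_eq_spline: "real (x choose n) = spline (Suc n) (int n - 1) x"
proof (cases "n \<le> x")
  case True
  then have "nat (int x - (int n - 1) - 1) + n = x" by linarith
  with True show ?thesis by (simp add: spline_Suc)
qed (simp add: spline_Suc)

lemma binomial_add_eq_spline: "real ((x + n) choose n) = spline (Suc n) (- 1) x"
  by (simp add: spline_Suc)

text \<open>Summing in the knot raises the order. This is Pascal's rule away from the knot; together with
\<open>spline_shift\<close>, which trades a step of the argument for a step of the knot, it gives both the
differences in \<open>x\<close> below and, after taking expectations, the action of \<^const>\<open>inv_fdiff\<close>.\<close>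

lemma spline_pascal: "spline (Suc r) j x - spline (Suc r) (j + 1) x = spline r j x"
proof (cases r)
  case 0
  then show ?thesis by (auto simp: spline_0 spline_1)
next
  case (Suc n)
  consider "int x \<le> j" | "int x = j + 1" | "j + 1 < int x" by linarith
  then show ?thesis
  proof cases
    case 3
    define m where "m = nat (int x - j - 2)"
    have "nat (int x - j - 1) = Suc m" using 3 by (simp add: m_def)
    moreover have "(Suc m + Suc n choose Suc n) = (m + Suc n choose n) + (m + Suc n choose Suc n)"
      by simp
    ultimately show ?thesis
      unfolding Suc spline_Suc using 3 by (simp add: m_def[symmetric])
  qed (auto simp: spline_Suc Suc)
qed

lemma spline_antimono: "j' \<le> j \<Longrightarrow> 0 < r \<Longrightarrow> spline r j x \<le> spline r j' x"
proof (induction j rule: int_ge_induct)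
  case (step i)
  obtain n where "r = Suc n" using step.prems by (cases r) auto
  then show ?case using step spline_pascal[of n i x] spline_nonneg[of n i x] by auto
qed simp

lemma spline_mono_order: "r \<le> r' \<Longrightarrow> spline r j x \<le> spline r' j x"
proof (induction r' rule: dec_induct)
  case (step n)
  then show ?case using spline_pascal[of n j x] spline_nonneg[of "Suc n" "j + 1" x] by linarith
qed simp

lemma fdiff_spline: "fdiff (spline (Suc r) j) = spline r (j - 1)"
  using spline_pascal[of r "j - 1"] by (auto simp: fdiff_def spline_shift)

lemma fdiff_pow_spline: "i \<le> r \<Longrightarrow> (fdiff ^^ i) (spline r j) = spline (r - i) (j - int i)"
proof (induction i)
  case (Suc i)
  then have "r - i = Suc (r - Suc i)" by simp
  with Suc show ?case by (simp add: fdiff_spline algebra_simps)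
qed simp

lemma fdiff_pow_spline_beyond:
  "(fdiff ^^ (m + r)) (spline r j) = (fdiff ^^ m) (spline 0 (j - int r))"
  by (simp add: funpow_add fdiff_pow_spline)

lemma fdiff_zero: "fdiff (\<lambda>_. 0) = (\<lambda>_. 0)"
  by (simp add: fdiff_def fun_eq_iff)

lemma fdiff_pow_zero: "(fdiff ^^ m) (\<lambda>_. 0) = (\<lambda>_. 0)"
  by (induction m) (simp_all add: fdiff_zero)

text \<open>Differencing a spline of order \<open>r\<close> more than \<open>r\<close> times produces differences of a point mass, which
change sign, unless the point mass has moved out of the naturals. The second alternative is the case
in which the spline is a polynomial on all of the naturals.\<close>

lemma fdiff_pow_spline_nonneg:
  assumes "i \<le> r \<or> j + 2 \<le> int r"
  shows "0 \<le> (fdiff ^^ i) (spline r j) x"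
proof (cases "i \<le> r")
  case False
  then have "spline 0 (j - int r) = (\<lambda>_. 0)"
    using assms by (auto simp: spline_0 fun_eq_iff)
  then show ?thesis
    using fdiff_pow_spline_beyond[of "i - r" r j] False by (simp add: fdiff_pow_zero)
qed (simp add: fdiff_pow_spline spline_nonneg)

lemma fdiff_pow_bounded:
  assumes "\<And>x. \<bar>f x\<bar> \<le> c"
  shows "\<bar>(fdiff ^^ m) f x\<bar> \<le> 2 ^ m * c"
proof (induction m arbitrary: x)
  case (Suc m)
  then have "\<bar>(fdiff ^^ m) f (Suc x)\<bar> \<le> 2 ^ m * c" "\<bar>(fdiff ^^ m) f x\<bar> \<le> 2 ^ m * c" by auto
  then show ?case unfolding funpow.simps o_def fdiff_def Suc_eq_plus1[symmetric] power_Suc by linarith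
qed (simp add: assms)

text \<open>The first difference of a point mass is still bounded by \<open>1\<close>, and each further one at most doubles the
bound. This is the origin of the factor \<open>2 ^ (s - k - 1)\<close> in the final estimate; truncated subtraction
covers the point mass itself.\<close>

lemma fdiff_pow_spline_0_bound: "\<bar>(fdiff ^^ m) (spline 0 j) x\<bar> \<le> 2 ^ (m - 1)"
proof (cases m)
  case (Suc n)
  have "\<bar>fdiff (spline 0 j) y\<bar> \<le> 1" for y by (auto simp: fdiff_def spline_0)
  from fdiff_pow_bounded[OF this, where m = n and x = x] show ?thesis
    by (simp add: Suc funpow_swap1)
qed (auto simp: spline_0)

text \<open>Multiplication by \<open>x\<close>, which is what size biasing does to a test function, keeps the knot and involves
only the present and the next order. This is the absorption identity for binomial coefficients.\<close>

lemma times_spline: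
  "real x * spline r j x = real r * spline (Suc r) j x + of_int (j + 1 - int r) * spline r j x"
proof (cases r)
  case (Suc n)
  show ?thesis
  proof (cases "j < int x")
    case True
    define y where "y = nat (int x - j - 1)"
    have y: "int x = int y + j + 1" using True by (simp add: y_def)
    have "real x = of_int (int x)" by simp
    also have "\<dots> = real y + of_int j + 1" unfolding y by simp
    finally have x: "real x = real y + of_int j + 1" .
    have "Suc n * (Suc (y + n) choose Suc n) = Suc (y + n) * ((y + n) choose n)"
      using Suc_times_binomial_eq[of "y + n" n] by (simp add: mult.commute)
    then have "real (Suc n * (Suc (y + n) choose Suc n)) = real (Suc (y + n) * ((y + n) choose n))"
      by (rule arg_cong)
    then have "real (Suc n) * real (Suc (y + n) choose Suc n) = (real y + real n + 1) * real ((y + n) choose n)"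
      unfolding of_nat_mult by (simp add: algebra_simps)
    then show ?thesis
      using True unfolding Suc spline_Suc y_def[symmetric] x
      by (simp add: algebra_simps)
  qed (simp add: Suc spline_Suc)
qed (auto simp: spline_0)

text \<open>Newton's forward difference formula with remainder: the binomial coefficients of degree at most \<open>s\<close> and the
splines of order \<open>s + 1\<close> generate the functions with nonnegative differences of orders up to \<open>s + 1\<close>.
The upper limit \<open>K\<close> only has to be at least the argument, because later splines vanish there; keeping it
fixed lets the inductive proof difference both sides in \<open>x\<close>.\<close>

lemma newton_expansion:
  assumes "x \<le> K"
  shows "f x = (\<Sum>i\<le>s. (fdiff ^^ i) f 0 * spline (Suc i) (int i - 1) x)
     + (\<Sum>j<K. (fdiff ^^ Suc s) f j * spline (Suc s) (int (j + s)) x)"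
  using assms
proof (induction s arbitrary: f x)
  case 0
  have "(\<Sum>j<K. fdiff f j * spline (Suc 0) (int j) x) = (\<Sum>j<x. fdiff f j)"
    using 0 by (intro sum.mono_neutral_cong_right) (auto simp: spline_1)
  also have "\<dots> = f x - f 0"
    by (simp add: fdiff_def sum_lessThan_telescope)
  finally show ?case by (simp add: spline_1)
next
  case (Suc s)
  let ?R = "\<lambda>x. (\<Sum>i\<le>Suc s. (fdiff ^^ i) f 0 * spline (Suc i) (int i - 1) x)
     + (\<Sum>j<K. (fdiff ^^ Suc (Suc s)) f j * spline (Suc (Suc s)) (int (j + Suc s)) x)"
  \<comment> \<open>Differencing the expansion of order \<open>s + 1\<close> of \<open>f\<close> gives the expansion of order \<open>s\<close> of \<open>\<Delta>f\<close>.\<close>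
  have diff: "?R (Suc y) - ?R y = fdiff f y" if "y \<le> K" for y
  proof -
    have d: "spline (Suc n) j (Suc y) - spline (Suc n) j y = spline n (j - 1) y" for n j
      using fdiff_spline[of n j] by (simp add: fdiff_def fun_eq_iff)
    have "?R (Suc y) - ?R y =
       (\<Sum>i\<le>Suc s. (fdiff ^^ i) f 0 * spline i (int i - 1 - 1) y)
     + (\<Sum>j<K. (fdiff ^^ Suc (Suc s)) f j * spline (Suc s) (int (j + Suc s) - 1) y)"
      unfolding d[symmetric] right_diff_distrib sum_subtractf by simp
    also have "\<dots> = (\<Sum>i\<le>s. (fdiff ^^ i) (fdiff f) 0 * spline (Suc i) (int i - 1) y)
     + (\<Sum>j<K. (fdiff ^^ Suc s) (fdiff f) j * spline (Suc s) (int (j + s)) y)"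
      unfolding sum.atMost_Suc_shift
      by (simp add: spline_0 funpow_swap1)
    finally show ?thesis using Suc.IH[OF that, of "fdiff f"] by simp
  qed
  from \<open>x \<le> K\<close> show ?case
  proof (induction x)
    case 0
    have "?R 0 = f 0"
      unfolding sum.atMost_Suc_shift by (simp add: spline_1 spline_Suc)
    then show ?case by simp
  next
    case (Suc x)
    then have "?R (Suc x) = ?R x + fdiff f x" using diff[of x] by linarith
    moreover have "f x = ?R x" using Suc by simp
    moreover have "f (Suc x) = f x + fdiff f x" by (simp add: fdiff_def)
    ultimately show ?case by linarith
  qed
qed

section \<open>Laws that dominate their size-biased version\<close>

text \<open>If \<open>p\<close> is the law of \<open>W\<close> with mean \<open>lam\<close>, this says \<open>E f(W*) \<le> E f(W + 1)\<close> for nonnegative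
\<open>s\<close>-convex \<open>f\<close>, since \<open>lam E f(W*) = E (W f(W))\<close>. Upper integrals are used because the existence of
moments is one of the consequences to be drawn from it.\<close>

definition size_bias_cx :: "nat \<Rightarrow> real \<Rightarrow> nat pmf \<Rightarrow> bool" where
  "size_bias_cx s lam p \<longleftrightarrow>
     (\<forall>f. (\<forall>x. 0 \<le> f x) \<longrightarrow> (\<forall>i\<in>{1..s}. \<forall>x. 0 \<le> (fdiff ^^ i) f x) \<longrightarrow>
        (\<integral>\<^sup>+x. ennreal (real x * f x) \<partial>p) \<le> ennreal lam * (\<integral>\<^sup>+x. ennreal (f (Suc x)) \<partial>p))"

definition spline_mean :: "nat pmf \<Rightarrow> nat \<Rightarrow> int \<Rightarrow> real" where
  "spline_mean p r j = measure_pmf.expectation p (spline r j)"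

lemma size_bias_cx_spline:
  assumes "size_bias_cx s lam p" "s \<le> r \<or> j + 2 \<le> int r"
  shows "(\<integral>\<^sup>+x. ennreal (real x * spline r j x) \<partial>p) \<le> ennreal lam * (\<integral>\<^sup>+x. ennreal (spline r (j - 1) x) \<partial>p)"
proof -
  have "0 \<le> (fdiff ^^ i) (spline r j) x" if "i \<in> {1..s}" for i x
    using assms(2) that by (intro fdiff_pow_spline_nonneg) auto
  then show ?thesis
    using assms(1) spline_nonneg[of r j] unfolding size_bias_cx_def spline_shift[symmetric] by blast
qed

text \<open>All moments are finite: by \<open>times_spline\<close> the spline of the next order is controlled by \<open>x\<close> times the
present one, and size-bias dominance bounds the expectation of that by an expectation of the present order. This
needs test functions whose differences of every order are nonnegative, hence negative knots; moving
the knot to the right only decreases a spline.\<close>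

lemma spline_nn_integral_finite:
  assumes "size_bias_cx s lam p"
  shows "(\<integral>\<^sup>+x. ennreal (spline r j x) \<partial>p) < \<infinity>"
proof -
  have bounded: "(\<integral>\<^sup>+x. ennreal (spline r j x) \<partial>p) < \<infinity>" if "\<And>x. spline r j x \<le> 1" for r j
  proof -
    have "(\<integral>\<^sup>+x. ennreal (spline r j x) \<partial>p) \<le> (\<integral>\<^sup>+x. 1 \<partial>p)"
      using that by (intro nn_integral_mono) (simp add: ennreal_le_1)
    also have "\<dots> = 1" by simp
    finally show ?thesis by (rule le_less_trans) simp
  qed
  have Suc: "(\<integral>\<^sup>+x. ennreal (spline (Suc n) j x) \<partial>p) < \<infinity>" for n j
  proof (induction n arbitrary: j)
    case 0
    show ?case by (rule bounded) (simp add: spline_1)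
  next
    case (Suc n)
    have neg: "(\<integral>\<^sup>+x. ennreal (spline (Suc (Suc n)) i x) \<partial>p) < \<infinity>" if i: "i \<le> - 1" for i
    proof -
      define c where "c = real_of_int (int (Suc n) - 1 - i)"
      have c: "0 \<le> c" using i by (simp add: c_def)
      have "spline (Suc (Suc n)) i x \<le> real x * spline (Suc n) i x + c * spline (Suc n) i x" for x
      proof -
        have "spline (Suc (Suc n)) i x \<le> real (Suc n) * spline (Suc (Suc n)) i x"
          using spline_nonneg[of "Suc (Suc n)" i x] mult_right_mono[of 1 "real (Suc n)"] by simp
        also have "\<dots> = real x * spline (Suc n) i x + c * spline (Suc n) i x"
          using times_spline[of x "Suc n" i] by (simp add: c_def algebra_simps)
        finally show ?thesis .
      qed
      then have "(\<integral>\<^sup>+x. ennreal (spline (Suc (Suc n)) i x) \<partial>p)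
          \<le> (\<integral>\<^sup>+x. ennreal (real x * spline (Suc n) i x) + ennreal c * ennreal (spline (Suc n) i x) \<partial>p)"
        using c spline_nonneg
        by (intro nn_integral_mono)
           (simp add: ennreal_mult''[symmetric] ennreal_plus[symmetric] ennreal_leI del: ennreal_plus)
      also have "\<dots> = (\<integral>\<^sup>+x. ennreal (real x * spline (Suc n) i x) \<partial>p)
          + ennreal c * (\<integral>\<^sup>+x. ennreal (spline (Suc n) i x) \<partial>p)"
        by (simp add: nn_integral_add nn_integral_cmult)
      also have "\<dots> \<le> ennreal lam * (\<integral>\<^sup>+x. ennreal (spline (Suc n) (i - 1) x) \<partial>p)
          + ennreal c * (\<integral>\<^sup>+x. ennreal (spline (Suc n) i x) \<partial>p)"
        using i by (intro add_right_mono size_bias_cx_spline[OF assms]) simp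
      also have "\<dots> < \<infinity>"
        using Suc[of "i - 1"] Suc[of i] by (simp add: ennreal_mult_less_top)
      finally show ?thesis .
    qed
    have "(\<integral>\<^sup>+x. ennreal (spline (Suc (Suc n)) j x) \<partial>p)
        \<le> (\<integral>\<^sup>+x. ennreal (spline (Suc (Suc n)) (min j (- 1)) x) \<partial>p)"
      by (intro nn_integral_mono ennreal_leI spline_antimono) auto
    also have "\<dots> < \<infinity>" by (rule neg) simp
    finally show ?case .
  qed
  show ?thesis
  proof (cases r)
    case 0
    show ?thesis unfolding 0 by (rule bounded) (simp add: spline_0)
  qed (simp only: Suc)
qed

lemma integrable_spline:
  assumes "size_bias_cx s lam p"
  shows "integrable (measure_pmf p) (spline r j)"
  using spline_nn_integral_finite[OF assms, of r j] spline_nonneg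
  by (intro integrableI_nonneg) auto

lemma integrable_times_spline:
  assumes "size_bias_cx s lam p"
  shows "integrable (measure_pmf p) (\<lambda>x. real x * spline r j x)"
  unfolding times_spline by (intro Bochner_Integration.integrable_add integrable_mult_right integrable_spline[OF assms])

lemma spline_mean_times:
  assumes "size_bias_cx s lam p"
  shows "measure_pmf.expectation p (\<lambda>x. real x * spline r j x)
       = real r * spline_mean p (Suc r) j + of_int (j + 1 - int r) * spline_mean p r j"
  unfolding times_spline spline_mean_def
  by (subst Bochner_Integration.integral_add) (auto intro: integrable_spline[OF assms])

lemma nn_integral_spline:
  assumes "size_bias_cx s lam p"
  shows "(\<integral>\<^sup>+x. ennreal (spline r j x) \<partial>p) = ennreal (spline_mean p r j)"
    and "(\<integral>\<^sup>+x. ennreal (real x * spline r j x) \<partial>p)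
       = ennreal (real r * spline_mean p (Suc r) j + of_int (j + 1 - int r) * spline_mean p r j)"
  unfolding spline_mean_times[OF assms, symmetric] unfolding spline_mean_def
  by (intro nn_integral_eq_integral integrable_spline[OF assms] integrable_times_spline[OF assms];
      simp add: spline_nonneg)+

lemma spline_mean_nonneg: "0 \<le> spline_mean p r j"
  unfolding spline_mean_def by (simp add: spline_nonneg)

text \<open>The basic inequality: size-bias dominance tested on a spline becomes a recursion for the spline means.\<close>

lemma spline_mean_size_bias:
  assumes "size_bias_cx s lam p" "0 \<le> lam" "s \<le> r \<or> j + 2 \<le> int r"
  shows "real r * spline_mean p (Suc r) j + of_int (j + 1 - int r) * spline_mean p r j
     \<le> lam * spline_mean p r (j - 1)"
  using size_bias_cx_spline[OF assms(1,3)] assms(2)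
  by (simp add: nn_integral_spline[OF assms(1)] ennreal_mult''[symmetric] spline_mean_nonneg ennreal_le_iff)

lemma spline_mean_pascal:
  assumes "size_bias_cx s lam p"
  shows "spline_mean p (Suc r) j - spline_mean p (Suc r) (j + 1) = spline_mean p r j"
proof -
  have "spline r j = (\<lambda>x. spline (Suc r) j x - spline (Suc r) (j + 1) x)"
    by (simp add: fun_eq_iff spline_pascal)
  then have "spline_mean p r j
      = measure_pmf.expectation p (\<lambda>x. spline (Suc r) j x - spline (Suc r) (j + 1) x)"
    by (simp add: spline_mean_def)
  also have "\<dots> = spline_mean p (Suc r) j - spline_mean p (Suc r) (j + 1)"
    unfolding spline_mean_def
    by (intro Bochner_Integration.integral_diff integrable_spline[OF assms])
  finally show ?thesis by simp
qed

lemma spline_mean_tendsto_0: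
  assumes "size_bias_cx s lam p"
  shows "(\<lambda>n. spline_mean p (Suc r) (j + int n)) \<longlonglongrightarrow> 0"
proof -
  have "(\<lambda>n. measure_pmf.expectation p (spline (Suc r) (j + int n)))
      \<longlonglongrightarrow> measure_pmf.expectation p (\<lambda>_. 0)"
  proof (rule integral_dominated_convergence[where w = "spline (Suc r) j"])
    show "AE x in p. (\<lambda>n. spline (Suc r) (j + int n) x) \<longlonglongrightarrow> 0"
    proof (rule AE_I2)
      fix x
      have "\<forall>\<^sub>F n in sequentially. spline (Suc r) (j + int n) x = 0"
        using eventually_ge_at_top[of "nat (int x - j)"]
        by eventually_elim (auto simp: spline_Suc)
      then show "(\<lambda>n. spline (Suc r) (j + int n) x) \<longlonglongrightarrow> 0"
        by (rule tendsto_eventually)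
    qed
  qed (auto intro!: integrable_spline[OF assms] AE_I2 spline_antimono simp: spline_nonneg)
  then show ?thesis by (simp add: spline_mean_def)
qed

section \<open>Comparison of spline means\<close>

text \<open>A sequence that tends to \<open>0\<close> attains any negative minimum. At a minimum the neighbouring terms are at
least \<open>B m\<close>, so the inequality leaves \<open>s * B m \<ge> 0\<close> after cancellation.\<close>

lemma discrete_minimum_principle:
  fixes B :: "nat \<Rightarrow> real"
  assumes "0 < s" "0 \<le> lam" and "0 \<le> B 0" and "B \<longlonglongrightarrow> 0"
    and super: "\<And>a. real (Suc a) * B (Suc (Suc a)) + lam * B a \<le> (s + real (Suc a) + lam) * B (Suc a)"
  shows "0 \<le> B a"
proof (rule ccontr)
  assume neg: "\<not> 0 \<le> B a"
  then have "\<forall>\<^sub>F n in sequentially. B a < B n"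
    using order_tendstoD(1)[OF assms(4)] by simp
  then obtain K where K: "\<And>n. K \<le> n \<Longrightarrow> B a < B n" by (auto simp: eventually_sequentially)
  define m where "m = arg_min_on B {..max a K}"
  have le: "B m \<le> B n" if "n \<le> max a K" for n
    unfolding m_def using that by (intro arg_min_least) auto
  have m: "B m \<le> B n" for n
  proof (cases "n \<le> max a K")
    case False
    then have "B a < B n" using K[of n] by simp
    with le[of a] show ?thesis by simp
  qed (rule le)
  have "B m < 0" using m[of a] neg by simp
  then obtain l where l: "m = Suc l" using assms(3) by (cases m) auto
  have "real m * B m + lam * B m \<le> real m * B (Suc m) + lam * B l"
    using m assms(2) by (intro add_mono mult_left_mono) auto
  then have "0 \<le> s * B m" using super[of l] by (simp add: l algebra_simps)
  with \<open>B m < 0\<close> assms(1) show False by (simp add: zero_le_mult_iff)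
qed

text \<open>By \<open>spline_mean_pascal\<close> the recursion of \<open>spline_mean_size_bias\<close> can be written in terms of the means of
order \<open>s + 1\<close> alone. It is then a second-order difference inequality in the knot, with equality for \<open>q\<close>, and
the difference of the two means satisfies the hypotheses of the minimum principle. In the theorem \<open>q\<close> is the Poisson law, and this
argument takes the place of a sign analysis of the solutions of the Stein equation.\<close>

lemma spline_mean_le:
  assumes p: "size_bias_cx s lam p" and q: "size_bias_cx s lam q" and lam: "0 \<le> lam" and s: "1 \<le> s"
    and eq: "\<And>j. real s * spline_mean q (Suc s) j + of_int (j + 1 - int s) * spline_mean q s j
      = lam * spline_mean q s (j - 1)"
    and start: "spline_mean p (Suc s) (int s - 1) \<le> spline_mean q (Suc s) (int s - 1)"
  shows "spline_mean p (Suc s) (int s - 1 + int a) \<le> spline_mean q (Suc s) (int s - 1 + int a)"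
proof -
  define B where "B a = spline_mean q (Suc s) (int s - 1 + int a) - spline_mean p (Suc s) (int s - 1 + int a)" for a
  have "0 \<le> B a"
  proof (rule discrete_minimum_principle[where s = s and lam = lam])
    show "B \<longlonglongrightarrow> 0"
      unfolding B_def using spline_mean_tendsto_0[OF p] spline_mean_tendsto_0[OF q]
      by (auto intro!: tendsto_eq_intros)
    have combine: "A * (Q1 - P1) + l * (Q0 - P0) \<le> (S + A + l) * (Q - P)"
      if "S * P + A * (P - P1) \<le> l * (P0 - P)" "S * Q + A * (Q - Q1) = l * (Q0 - Q)"
      for A l S P P0 P1 Q Q0 Q1 :: real
      using that by (simp add: algebra_simps)
    fix a
    let ?j = "int s + int a"
    have i: "int s - 1 + int a = ?j - 1" "int s - 1 + int (Suc a) = ?j"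
      "int s - 1 + int (Suc (Suc a)) = ?j + 1" by auto
    have j: "real_of_int (?j + 1 - int s) = real (Suc a)" by simp
    have pp: "real s * spline_mean p (Suc s) ?j
        + real (Suc a) * (spline_mean p (Suc s) ?j - spline_mean p (Suc s) (?j + 1))
       \<le> lam * (spline_mean p (Suc s) (?j - 1) - spline_mean p (Suc s) ?j)"
      using spline_mean_size_bias[OF p lam, of s ?j]
        spline_mean_pascal[OF p, of s ?j] spline_mean_pascal[OF p, of s "?j - 1"]
      unfolding j by simp
    have qq: "real s * spline_mean q (Suc s) ?j
        + real (Suc a) * (spline_mean q (Suc s) ?j - spline_mean q (Suc s) (?j + 1))
       = lam * (spline_mean q (Suc s) (?j - 1) - spline_mean q (Suc s) ?j)"
      using eq[of ?j] spline_mean_pascal[OF q, of s ?j] spline_mean_pascal[OF q, of s "?j - 1"]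
      unfolding j by simp
    show "real (Suc a) * B (Suc (Suc a)) + lam * B a \<le> (real s + real (Suc a) + lam) * B (Suc a)"
      unfolding B_def i by (rule combine[OF pp qq])
  qed (use s lam start in \<open>auto simp: B_def\<close>)
  then show ?thesis by (simp add: B_def)
qed

text \<open>For nonnegative differences every term of the Newton expansion is nonnegative, so it may be integrated
term by term without any growth condition on \<open>f\<close>.\<close>

lemma newton_expansion_ennreal:
  assumes "\<And>i x. i \<le> Suc s \<Longrightarrow> 0 \<le> (fdiff ^^ i) f x"
  shows "ennreal (f x) =
       (\<Sum>i\<le>s. ennreal ((fdiff ^^ i) f 0) * ennreal (spline (Suc i) (int i - 1) x))
     + (\<Sum>j. ennreal ((fdiff ^^ Suc s) f j) * ennreal (spline (Suc s) (int (j + s)) x))"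
proof -
  have nn: "0 \<le> (fdiff ^^ Suc s) f j" for j by (rule assms) simp
  have "(\<Sum>j. ennreal ((fdiff ^^ Suc s) f j) * ennreal (spline (Suc s) (int (j + s)) x))
      = (\<Sum>j<x. ennreal ((fdiff ^^ Suc s) f j) * ennreal (spline (Suc s) (int (j + s)) x))"
    by (intro suminf_finite) (auto simp: spline_Suc)
  also have "\<dots> = ennreal (\<Sum>j<x. (fdiff ^^ Suc s) f j * spline (Suc s) (int (j + s)) x)"
    unfolding ennreal_mult[OF nn spline_nonneg, symmetric]
    by (rule sum_ennreal) (intro mult_nonneg_nonneg nn spline_nonneg)
  finally have a: "(\<Sum>j. ennreal ((fdiff ^^ Suc s) f j) * ennreal (spline (Suc s) (int (j + s)) x))
      = ennreal (\<Sum>j<x. (fdiff ^^ Suc s) f j * spline (Suc s) (int (j + s)) x)" .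
  have b: "(\<Sum>i\<le>s. ennreal ((fdiff ^^ i) f 0) * ennreal (spline (Suc i) (int i - 1) x))
      = ennreal (\<Sum>i\<le>s. (fdiff ^^ i) f 0 * spline (Suc i) (int i - 1) x)"
  proof -
    have "(\<Sum>i\<le>s. ennreal ((fdiff ^^ i) f 0) * ennreal (spline (Suc i) (int i - 1) x))
      = (\<Sum>i\<le>s. ennreal ((fdiff ^^ i) f 0 * spline (Suc i) (int i - 1) x))"
      by (intro sum.cong refl ennreal_mult[symmetric] assms spline_nonneg) simp
    also have "\<dots> = ennreal (\<Sum>i\<le>s. (fdiff ^^ i) f 0 * spline (Suc i) (int i - 1) x)"
      by (rule sum_ennreal) (intro mult_nonneg_nonneg assms spline_nonneg; simp)
    finally show ?thesis .
  qed
  have "ennreal (f x) = ennreal ((\<Sum>i\<le>s. (fdiff ^^ i) f 0 * spline (Suc i) (int i - 1) x)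
     + (\<Sum>j<x. (fdiff ^^ Suc s) f j * spline (Suc s) (int (j + s)) x))"
    by (rule arg_cong[OF newton_expansion]) (rule order_refl)
  also have "\<dots> = ennreal (\<Sum>i\<le>s. (fdiff ^^ i) f 0 * spline (Suc i) (int i - 1) x)
     + ennreal (\<Sum>j<x. (fdiff ^^ Suc s) f j * spline (Suc s) (int (j + s)) x)"
    by (rule ennreal_plus) (intro sum_nonneg mult_nonneg_nonneg nn assms spline_nonneg; simp)+
  finally show ?thesis unfolding a b .
qed

text \<open>The generators of the cone of functions with nonnegative differences decide the comparison on the whole cone.\<close>

lemma cx_comparison:
  assumes p: "size_bias_cx s lam p" and q: "size_bias_cx s lam q"
    and poly: "\<And>i. i \<le> s \<Longrightarrow> spline_mean p (Suc i) (int i - 1) \<le> spline_mean q (Suc i) (int i - 1)"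
    and trunc: "\<And>j. spline_mean p (Suc s) (int (j + s)) \<le> spline_mean q (Suc s) (int (j + s))"
    and f: "\<And>i x. i \<le> Suc s \<Longrightarrow> 0 \<le> (fdiff ^^ i) f x"
  shows "(\<integral>\<^sup>+x. ennreal (f x) \<partial>p) \<le> (\<integral>\<^sup>+x. ennreal (f x) \<partial>q)"
proof -
  have expand: "(\<integral>\<^sup>+x. ennreal (f x) \<partial>u) =
       (\<Sum>i\<le>s. ennreal ((fdiff ^^ i) f 0) * ennreal (spline_mean u (Suc i) (int i - 1)))
     + (\<Sum>j. ennreal ((fdiff ^^ Suc s) f j) * ennreal (spline_mean u (Suc s) (int (j + s))))"
    if u: "size_bias_cx s lam u" for u
  proof -
    let ?A = "\<lambda>x. \<Sum>i\<le>s. ennreal ((fdiff ^^ i) f 0) * ennreal (spline (Suc i) (int i - 1) x)"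
    let ?B = "\<lambda>x. \<Sum>j. ennreal ((fdiff ^^ Suc s) f j) * ennreal (spline (Suc s) (int (j + s)) x)"
    have "(\<integral>\<^sup>+x. ennreal (f x) \<partial>u) = (\<integral>\<^sup>+x. ?A x + ?B x \<partial>u)"
      by (intro nn_integral_cong newton_expansion_ennreal f)
    also have "\<dots> = (\<integral>\<^sup>+x. ?A x \<partial>u) + (\<integral>\<^sup>+x. ?B x \<partial>u)"
      by (rule nn_integral_add) simp_all
    also have "(\<integral>\<^sup>+x. ?A x \<partial>u)
        = (\<Sum>i\<le>s. ennreal ((fdiff ^^ i) f 0) * ennreal (spline_mean u (Suc i) (int i - 1)))"
      unfolding nn_integral_spline(1)[OF u, symmetric]
      by (subst nn_integral_sum) (simp_all add: nn_integral_cmult)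
    also have "(\<integral>\<^sup>+x. ?B x \<partial>u)
        = (\<Sum>j. ennreal ((fdiff ^^ Suc s) f j) * ennreal (spline_mean u (Suc s) (int (j + s))))"
      unfolding nn_integral_spline(1)[OF u, symmetric]
      by (subst nn_integral_suminf) (simp_all add: nn_integral_cmult del: funpow.simps)
    finally show ?thesis .
  qed
  show ?thesis
    unfolding expand[OF p] expand[OF q]
    using poly trunc
    by (intro add_mono sum_mono suminf_le mult_left_mono ennreal_leI) auto
qed

section \<open>From the convex order to distances\<close>

lemma fdiff_pow_linear:
  "(fdiff ^^ i) (\<lambda>x. a * f x + b * g x) = (\<lambda>x. a * (fdiff ^^ i) f x + b * (fdiff ^^ i) g x)"
  by (induction i) (simp_all add: fdiff_def fun_eq_iff algebra_simps)

text \<open>The polynomial of order \<open>s + 2\<close> with knot \<open>-1\<close>, that is \<open>(x + s + 1) choose (s + 1)\<close>, majorises all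
differences of the spline: those of order at most \<open>r\<close> because splines increase with the order and decrease
with the knot, the later ones because they are bounded by powers of \<open>2\<close>, while the polynomial's
differences are at least \<open>1\<close>.\<close>

lemma fdiff_pow_spline_le:
  assumes "r \<le> s + 2" "i \<le> Suc s" "- 1 \<le> j"
  shows "\<bar>(fdiff ^^ i) (spline r j) x\<bar> \<le> 2 ^ (s - r) * (fdiff ^^ i) (spline (s + 2) (- 1)) x"
proof (cases "i \<le> r")
  case True
  have "spline (r - i) (j - int i) x \<le> spline (s + 2 - i) (j - int i) x"
    using assms by (intro spline_mono_order) auto
  also have "\<dots> \<le> spline (s + 2 - i) (- 1 - int i) x"
    using assms by (intro spline_antimono) auto
  also have "\<dots> \<le> 2 ^ (s - r) * spline (s + 2 - i) (- 1 - int i) x"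
    using mult_right_mono[of 1 "2 ^ (s - r)" "spline (s + 2 - i) (- 1 - int i) x"]
    by (simp add: spline_nonneg)
  finally show ?thesis using True assms by (simp add: fdiff_pow_spline spline_nonneg)
next
  case False
  define n where "n = s + 1 - i"
  have n: "s + 2 - i = Suc n" using assms by (simp add: n_def)
  have "1 = spline (Suc 0) (- 1 - int i) x" by (simp add: spline_1)
  also have "\<dots> \<le> spline (s + 2 - i) (- 1 - int i) x" unfolding n by (intro spline_mono_order) simp
  finally have one: "1 \<le> (fdiff ^^ i) (spline (s + 2) (- 1)) x"
    using assms by (simp add: fdiff_pow_spline)
  have "(fdiff ^^ i) (spline r j) = (fdiff ^^ (i - r)) (spline 0 (j - int r))"
    using fdiff_pow_spline_beyond[of "i - r" r j] False by simp
  then have "\<bar>(fdiff ^^ i) (spline r j) x\<bar> \<le> 2 ^ (i - r - 1)"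
    using fdiff_pow_spline_0_bound[of "i - r" "j - int r" x] by simp
  also have "\<dots> \<le> 2 ^ (s - r) * 1" using assms by simp
  also have "\<dots> \<le> 2 ^ (s - r) * (fdiff ^^ i) (spline (s + 2) (- 1)) x"
    using one by (intro mult_left_mono) auto
  finally show ?thesis .
qed

text \<open>By \<open>fdiff_pow_spline_le\<close>, the multiple of the majorising polynomial plus or minus the spline has
nonnegative differences up to the order \<open>s + 1\<close>. Comparing expectations for both signs gives the absolute value.\<close>

lemma spline_mean_distance:
  assumes p: "size_bias_cx s lam p" and q: "size_bias_cx s lam q"
    and poly: "\<And>i. i \<le> s \<Longrightarrow> spline_mean p (Suc i) (int i - 1) \<le> spline_mean q (Suc i) (int i - 1)"
    and trunc: "\<And>j. spline_mean p (Suc s) (int (j + s)) \<le> spline_mean q (Suc s) (int (j + s))"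
    and r: "r \<le> s + 2" and j: "- 1 \<le> j"
  shows "\<bar>spline_mean p r j - spline_mean q r j\<bar>
     \<le> 2 ^ (s - r) * (spline_mean q (s + 2) (- 1) - spline_mean p (s + 2) (- 1))"
proof -
  let ?c = "2 ^ (s - r) :: real" and ?P = "spline (s + 2) (- 1)"
  have le: "?c * spline_mean p (s + 2) (- 1) + b * spline_mean p r j
      \<le> ?c * spline_mean q (s + 2) (- 1) + b * spline_mean q r j" if b: "\<bar>b\<bar> = 1" for b
  proof -
    let ?f = "\<lambda>x. ?c * ?P x + b * spline r j x"
    have nonneg: "0 \<le> (fdiff ^^ i) ?f x" if "i \<le> Suc s" for i x
    proof -
      have "\<bar>b * (fdiff ^^ i) (spline r j) x\<bar> \<le> ?c * (fdiff ^^ i) ?P x"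
        using fdiff_pow_spline_le[OF r that j] b by (simp add: abs_mult)
      then show ?thesis unfolding fdiff_pow_linear by linarith
    qed
    have f0: "0 \<le> ?f x" for x using nonneg[of 0 x] by simp
    have mean: "measure_pmf.expectation u ?f = ?c * spline_mean u (s + 2) (- 1) + b * spline_mean u r j"
      and int: "(\<integral>\<^sup>+x. ennreal (?f x) \<partial>u) = ennreal (measure_pmf.expectation u ?f)"
      if u: "size_bias_cx s lam u" for u
    proof -
      have i: "integrable (measure_pmf u) (\<lambda>x. ?c * ?P x)" "integrable (measure_pmf u) (\<lambda>x. b * spline r j x)"
        using integrable_spline[OF u] by (auto intro!: integrable_mult_right)
      show "measure_pmf.expectation u ?f = ?c * spline_mean u (s + 2) (- 1) + b * spline_mean u r j"
        by (subst Bochner_Integration.integral_add[OF i]) (simp add: spline_mean_def)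
      show "(\<integral>\<^sup>+x. ennreal (?f x) \<partial>u) = ennreal (measure_pmf.expectation u ?f)"
        by (intro nn_integral_eq_integral Bochner_Integration.integrable_add i AE_I2 f0)
    qed
    have "ennreal (measure_pmf.expectation p ?f) \<le> ennreal (measure_pmf.expectation q ?f)"
      unfolding int[OF p, symmetric] int[OF q, symmetric]
      by (intro cx_comparison[OF p q poly trunc] nonneg)
    moreover have "0 \<le> measure_pmf.expectation q ?f"
      using f0 by (intro Bochner_Integration.integral_nonneg) simp
    ultimately have "measure_pmf.expectation p ?f \<le> measure_pmf.expectation q ?f"
      by (simp add: ennreal_le_iff)
    then show ?thesis unfolding mean[OF p] mean[OF q] .
  qed
  show ?thesis using le[of 1] le[of "- 1"] by (simp add: abs_le_iff algebra_simps)
qed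

text \<open>Each application of \<^const>\<open>inv_fdiff\<close> raises the order by one and changes the sign: by
\<open>spline_mean_pascal\<close> the series telescopes, and its limit term vanishes.\<close>

lemma inv_fdiff_pow_spline_mean:
  assumes p: "size_bias_cx s lam p" and q: "size_bias_cx s lam q"
  shows "(inv_fdiff ^^ n) (\<lambda>j. c * (spline_mean p 1 (int j) - spline_mean q 1 (int j)))
     = (\<lambda>j. (- 1) ^ n * c * (spline_mean p (Suc n) (int j) - spline_mean q (Suc n) (int j)))"
proof (induction n)
  case (Suc n)
  show ?case
  proof
    fix j
    let ?D = "\<lambda>r i. spline_mean p r (int (j + i)) - spline_mean q r (int (j + i))"
    have "?D (Suc (Suc n)) \<longlonglongrightarrow> 0"
      using tendsto_diff[OF spline_mean_tendsto_0[OF p, of "Suc n" "int j"]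
          spline_mean_tendsto_0[OF q, of "Suc n" "int j"]] by simp
    then have "(\<lambda>i. ?D (Suc (Suc n)) i - ?D (Suc (Suc n)) (Suc i)) sums (?D (Suc (Suc n)) 0 - 0)"
      by (rule telescope_sums')
    moreover have "?D (Suc (Suc n)) i - ?D (Suc (Suc n)) (Suc i) = ?D (Suc n) i" for i
      using spline_mean_pascal[OF p, of "Suc n" "int (j + i)"]
        spline_mean_pascal[OF q, of "Suc n" "int (j + i)"]
      by (simp add: algebra_simps)
    ultimately have "?D (Suc n) sums ?D (Suc (Suc n)) 0" by simp
    then have "(\<lambda>i. (- 1) ^ n * c * ?D (Suc n) i) sums ((- 1) ^ n * c * ?D (Suc (Suc n)) 0)"
      by (rule sums_mult)
    then show "(inv_fdiff ^^ Suc n) (\<lambda>j. c * (spline_mean p 1 (int j) - spline_mean q 1 (int j))) j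
        = (- 1) ^ Suc n * c * (spline_mean p (Suc (Suc n)) (int j) - spline_mean q (Suc (Suc n)) (int j))"
      unfolding funpow.simps o_def Suc inv_fdiff_def using sums_unique by fastforce
  qed
qed simp

section \<open>Random variables and the Poisson law\<close>

lemma pmf_of_random_variable:
  fixes X :: "'a \<Rightarrow> nat"
  assumes "prob_space M" "X \<in> measurable M (count_space UNIV)"
  obtains p where "distr M (count_space UNIV) X = measure_pmf p"
proof -
  interpret prob_space M by fact
  define D where "D = distr M (count_space UNIV) X"
  interpret D: prob_space D unfolding D_def by (rule prob_space_distr) fact
  have sets: "sets D = UNIV" by (simp add: D_def)
  have "{x. measure D {x} = 0} = (\<Union>x\<in>{x. measure D {x} = 0}. {x})" by auto
  also have "\<dots> \<in> null_sets D"
    by (intro null_sets_UN') (auto simp: sets D.emeasure_eq_measure)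
  finally have "AE x in D. measure D {x} \<noteq> 0"
    by (rule AE_I') auto
  then have "measure_pmf (Abs_pmf D) = D"
    using sets D.prob_space_axioms by (intro Abs_pmf_inverse) simp
  then show ?thesis using that[of "Abs_pmf D"] by (simp add: D_def)
qed

lemma nn_integral_random_variable:
  fixes X :: "'a \<Rightarrow> nat" and f :: "nat \<Rightarrow> ennreal"
  assumes "X \<in> measurable M (count_space UNIV)" "distr M (count_space UNIV) X = measure_pmf p"
  shows "(\<integral>\<^sup>+\<omega>. f (X \<omega>) \<partial>M) = (\<integral>\<^sup>+x. f x \<partial>p)"
  unfolding assms(2)[symmetric] by (rule nn_integral_distr[symmetric]) (use assms(1) in auto)

lemma integral_random_variable:
  fixes X :: "'a \<Rightarrow> nat" and f :: "nat \<Rightarrow> real"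
  assumes "X \<in> measurable M (count_space UNIV)" "distr M (count_space UNIV) X = measure_pmf p"
  shows "(\<integral>\<omega>. f (X \<omega>) \<partial>M) = measure_pmf.expectation p f"
  unfolding assms(2)[symmetric] by (rule integral_distr[symmetric]) (use assms(1) in auto)

lemma prob_random_variable:
  fixes X :: "'a \<Rightarrow> nat"
  assumes "X \<in> measurable M (count_space UNIV)" "distr M (count_space UNIV) X = measure_pmf p"
  shows "\<P>(\<omega> in M. Q (X \<omega>)) = measure_pmf.prob p {x. Q x}"
proof -
  have "measure_pmf.prob p {x. Q x} = measure M (X -` {x. Q x} \<inter> space M)"
    unfolding assms(2)[symmetric] by (rule measure_distr) (use assms(1) in auto)
  also have "X -` {x. Q x} \<inter> space M = {\<omega> \<in> space M. Q (X \<omega>)}" by auto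
  finally show ?thesis by simp
qed

lemma nn_integral_nat_pmf:
  fixes f :: "nat \<Rightarrow> ennreal"
  shows "(\<integral>\<^sup>+x. f x \<partial>measure_pmf p) = (\<Sum>x. ennreal (pmf p x) * f x)"
  by (simp add: nn_integral_measure_pmf nn_integral_count_space_nat)

text \<open>The size-biased Poisson law is the law of \<open>Z + 1\<close>; termwise this is
\<open>(x + 1) P(Z = x + 1) = lam P(Z = x)\<close>. Thus size-bias dominance holds for the Poisson law
with equality, for every nonnegative test function.\<close>

lemma poisson_stein_identity:
  assumes lam: "0 < lam" and f: "\<And>x. 0 \<le> f x"
  shows "(\<integral>\<^sup>+x. ennreal (real x * f x) \<partial>poisson_pmf lam)
       = ennreal lam * (\<integral>\<^sup>+x. ennreal (f (Suc x)) \<partial>poisson_pmf lam)"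
proof -
  let ?\<pi> = "pmf (poisson_pmf lam)"
  have step: "ennreal (?\<pi> (Suc x)) * ennreal (real (Suc x) * f (Suc x))
      = ennreal lam * (ennreal (?\<pi> x) * ennreal (f (Suc x)))" for x
  proof -
    have "?\<pi> (Suc x) * real (Suc x) = lam * ?\<pi> x"
      using lam by (simp add: divide_simps del: of_nat_Suc)
    then have "?\<pi> (Suc x) * (real (Suc x) * f (Suc x)) = lam * (?\<pi> x * f (Suc x))"
      by (simp only: mult.assoc[symmetric])
    then have "ennreal (?\<pi> (Suc x)) * ennreal (real (Suc x) * f (Suc x)) = ennreal (lam * (?\<pi> x * f (Suc x)))"
      using f[of "Suc x"] by (subst ennreal_mult[symmetric]) (simp_all only: pmf_nonneg mult_nonneg_nonneg of_nat_0_le_iff)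
    also have "\<dots> = ennreal lam * (ennreal (?\<pi> x) * ennreal (f (Suc x)))"
      using f[of "Suc x"] lam by (simp only: ennreal_mult pmf_nonneg mult_nonneg_nonneg less_imp_le)
    finally show ?thesis .
  qed
  have "(\<integral>\<^sup>+x. ennreal (real x * f x) \<partial>poisson_pmf lam)
      = (\<Sum>x. ennreal (?\<pi> (Suc x)) * ennreal (real (Suc x) * f (Suc x)))"
    unfolding nn_integral_nat_pmf
    using suminf_offset[of "\<lambda>x. ennreal (?\<pi> x) * ennreal (real x * f x)" 1] by simp
  also have "\<dots> = ennreal lam * (\<Sum>x. ennreal (?\<pi> x) * ennreal (f (Suc x)))"
    unfolding step by (rule ennreal_suminf_cmult)
  finally show ?thesis unfolding nn_integral_nat_pmf .
qed

lemma size_bias_cx_poisson: "0 < lam \<Longrightarrow> size_bias_cx s lam (poisson_pmf lam)"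
  by (simp add: size_bias_cx_def poisson_stein_identity)

lemma spline_mean_poisson:
  assumes "0 < lam"
  shows "real r * spline_mean (poisson_pmf lam) (Suc r) j
      + of_int (j + 1 - int r) * spline_mean (poisson_pmf lam) r j
      = lam * spline_mean (poisson_pmf lam) r (j - 1)" (is "?l = ?r")
proof -
  note P = size_bias_cx_poisson[OF assms, of 1]
  have "0 \<le> ?l"
    unfolding spline_mean_times[OF P, symmetric]
    by (intro Bochner_Integration.integral_nonneg) (simp add: spline_nonneg)
  moreover have "ennreal ?l = ennreal ?r"
    using poisson_stein_identity[OF assms, of "spline r j"] assms
    by (simp add: spline_nonneg spline_shift nn_integral_spline[OF P] ennreal_mult''[symmetric] spline_mean_nonneg)
  ultimately show ?thesis using assms
    by (simp add: spline_mean_nonneg)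
qed

lemma size_bias_cx_of_s_cx_le:
  fixes M :: "'a measure" and L :: "'c measure" and W :: "'a \<Rightarrow> nat" and Wstar :: "'c \<Rightarrow> nat"
  assumes "prob_space L"
    and W: "W \<in> measurable M (count_space UNIV)" "distr M (count_space UNIV) W = measure_pmf p"
    and Wstar: "Wstar \<in> measurable L (count_space UNIV)"
    and lam: "0 < lam"
    and bias: "\<And>j. \<P>(\<omega> in L. Wstar \<omega> = j) = real j * \<P>(\<omega> in M. W \<omega> = j) / lam"
    and le: "s_cx_le s L Wstar M (\<lambda>\<omega>. W \<omega> + 1)"
  shows "size_bias_cx s lam p"
  unfolding size_bias_cx_def
proof (intro allI impI)
  fix f :: "nat \<Rightarrow> real"
  assume f: "\<forall>x. 0 \<le> f x" and d: "\<forall>i\<in>{1..s}. \<forall>x. 0 \<le> (fdiff ^^ i) f x"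
  obtain u where u: "distr L (count_space UNIV) Wstar = measure_pmf u"
    using pmf_of_random_variable[OF assms(1) Wstar] .
  have pmf_u: "pmf u j = real j * pmf p j / lam" for j
    using bias[of j]
    unfolding prob_random_variable[OF W, of "\<lambda>x. x = j"] prob_random_variable[OF Wstar u, of "\<lambda>x. x = j"]
    by (simp add: measure_pmf_single)
  have "ennreal (pmf p x) * ennreal (real x * f x) = ennreal lam * (ennreal (pmf u x) * ennreal (f x))" for x
  proof -
    have "pmf p x * (real x * f x) = lam * (pmf u x * f x)"
      using lam by (simp add: pmf_u)
    then show ?thesis using f lam by (simp add: ennreal_mult[symmetric])
  qed
  then have "(\<integral>\<^sup>+x. ennreal (real x * f x) \<partial>p) = ennreal lam * (\<integral>\<^sup>+x. ennreal (f x) \<partial>u)"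
    unfolding nn_integral_nat_pmf by (simp only: ennreal_suminf_cmult)
  also have "\<dots> \<le> ennreal lam * (\<integral>\<^sup>+x. ennreal (f (Suc x)) \<partial>p)"
  proof (rule mult_left_mono)
    have "ext_expectation L (\<lambda>\<omega>. f (Wstar \<omega>)) \<le> ext_expectation M (\<lambda>\<omega>. f (W \<omega> + 1))"
      using le d unfolding s_cx_le_def by (auto simp: diff_pow_def)
    moreover have "ennreal (- f x) = 0" for x using f by (simp add: ennreal_neg)
    ultimately have "enn2ereal (\<integral>\<^sup>+x. ennreal (f x) \<partial>u) \<le> enn2ereal (\<integral>\<^sup>+x. ennreal (f (Suc x)) \<partial>p)"
      unfolding ext_expectation_def
      using nn_integral_random_variable[OF Wstar u, of "\<lambda>x. ennreal (f x)"]
        nn_integral_random_variable[OF W, of "\<lambda>x. ennreal (f (Suc x))"]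
      by (simp add: zero_ennreal.rep_eq)
    then show "(\<integral>\<^sup>+x. ennreal (f x) \<partial>u) \<le> (\<integral>\<^sup>+x. ennreal (f (Suc x)) \<partial>p)"
      by (simp add: less_eq_ennreal.rep_eq)
  qed simp
  finally show "(\<integral>\<^sup>+x. ennreal (real x * f x) \<partial>p) \<le> ennreal lam * (\<integral>\<^sup>+x. ennreal (f (Suc x)) \<partial>p)" .
qed

section \<open>The distance bounds\<close>

text \<open>The comparison in degrees \<open>0\<close> and \<open>1\<close> is normalisation and equality of the means. Testing dominance on the identity gives \<open>E W\<^sup>2 \<le> lam (lam + 1)\<close>, which is
an equality for the Poisson law and, the means being equal, is the comparison in degree \<open>2\<close>.\<close>

lemma spline_mean_start_le:
  assumes p: "size_bias_cx s lam p" and lam: "0 < lam"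
    and mean: "measure_pmf.expectation p real = lam"
    and moments: "\<And>m. m \<in> {3..s} \<Longrightarrow> measure_pmf.expectation p (\<lambda>x. real (x choose m))
        \<le> measure_pmf.expectation (poisson_pmf lam) (\<lambda>x. real (x choose m))"
    and i: "i \<le> s"
  shows "spline_mean p (Suc i) (int i - 1) \<le> spline_mean (poisson_pmf lam) (Suc i) (int i - 1)"
proof -
  let ?q = "poisson_pmf lam"
  note q = size_bias_cx_poisson[OF lam, of s]
  have total: "spline_mean u 1 (- 1) = 1" for u
  proof -
    have "spline 1 (- 1) = (\<lambda>_. 1)" by (simp add: fun_eq_iff spline_1)
    then show ?thesis by (simp add: spline_mean_def)
  qed
  have stein: "1 * spline_mean ?q 2 0 = lam * spline_mean ?q 1 (- 1)"
    using spline_mean_poisson[OF lam, of 1 0] by (simp add: numeral_2_eq_2)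
  have "real x = spline 2 0 x" for x
    using binomial_eq_spline[of x 1] by (simp add: numeral_2_eq_2)
  then have mean_p: "spline_mean p 2 0 = lam"
    using mean unfolding spline_mean_def by presburger
  have mean_q: "spline_mean ?q 2 0 = lam" using stein total by simp
  consider "i = 0" | "i = 1" | "i = 2" | "i \<in> {3..s}" using i by force
  then show ?thesis
  proof cases
    case 3
    have pas: "spline_mean u 3 0 - spline_mean u 3 1 = spline_mean u 2 0"
      "spline_mean u 2 (- 1) - spline_mean u 2 0 = spline_mean u 1 (- 1)"
      if "size_bias_cx s lam u" for u
      using spline_mean_pascal[OF that, of 2 0] spline_mean_pascal[OF that, of 1 "- 1"]
      by (simp_all add: numeral_2_eq_2 numeral_3_eq_3)
    have "2 * spline_mean p 3 0 - spline_mean p 2 0 \<le> lam * spline_mean p 2 (- 1)"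
      using spline_mean_size_bias[OF p, of 2 0] lam by (simp add: numeral_3_eq_3 numeral_2_eq_2)
    moreover have "2 * spline_mean ?q 3 0 - spline_mean ?q 2 0 = lam * spline_mean ?q 2 (- 1)"
      using spline_mean_poisson[OF lam, of 2 0] by (simp add: numeral_3_eq_3 numeral_2_eq_2)
    moreover have "spline_mean p 2 (- 1) = spline_mean ?q 2 (- 1)"
      using pas(2)[OF p] pas(2)[OF q] mean_p mean_q total by simp
    ultimately have "spline_mean p 3 1 \<le> spline_mean ?q 3 1"
      using pas(1)[OF p] pas(1)[OF q] mean_p mean_q by simp
    then show ?thesis by (simp add: 3 numeral_3_eq_3 numeral_2_eq_2)
  next
    case 4
    then show ?thesis using moments[of i] by (simp add: spline_mean_def binomial_eq_spline)
  qed (use mean_p mean_q total in \<open>simp_all add: numeral_2_eq_2\<close>)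
qed

theorem corollary2p7:
  fixes M :: "'a measure" and N :: "'b measure" and L :: "'c measure"
    and W :: "'a \<Rightarrow> nat" and Z :: "'b \<Rightarrow> nat" and Wstar :: "'c \<Rightarrow> nat"
    and lam :: real and s :: nat and k :: int and F G :: "nat \<Rightarrow> real"
  assumes "prob_space M" and "prob_space N" and "prob_space L"
    and "W \<in> measurable M (count_space UNIV)"
    and "Z \<in> measurable N (count_space UNIV)"
    and "Wstar \<in> measurable L (count_space UNIV)"
    and "lam > 0"
    and "integrable M (\<lambda>\<omega>. real (W \<omega>))"
    and "(\<integral>\<omega>. real (W \<omega>) \<partial>M) = lam"
    and "distr N (count_space UNIV) Z = measure_pmf (poisson_pmf lam)"
    and "\<And>j. \<P>(\<omega> in L. Wstar \<omega> = j) = real j * \<P>(\<omega> in M. W \<omega> = j) / lam"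
    and "s \<ge> 1"
    and "\<And>m. m \<in> {3..s} \<Longrightarrow>
           (\<integral>\<omega>. real (W \<omega> choose m) \<partial>M) \<le> (\<integral>\<omega>. real (Z \<omega> choose m) \<partial>N)"
    and "s_cx_le s L Wstar M (\<lambda>\<omega>. W \<omega> + 1)"
    and "\<And>j. F j = \<P>(\<omega> in M. W \<omega> \<le> j)"
    and "\<And>j. G j = \<P>(\<omega> in N. Z \<omega> \<le> j)"
    and "k \<in> {-1..int s + 1}"
  shows "d_inf (- k) F G \<le>
    ereal (2 ^ nat (max (int s - k - 1) 0) *
      ((\<integral>\<omega>. real ((Z \<omega> + s + 1) choose (s + 1)) \<partial>N)
       - (\<integral>\<omega>. real ((W \<omega> + s + 1) choose (s + 1)) \<partial>M)))"
proof -
  note lam = \<open>lam > 0\<close> and Wm = assms(4) and Zm = assms(5) and Zd = assms(10)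
  let ?q = "poisson_pmf lam"
  obtain p where Wd: "distr M (count_space UNIV) W = measure_pmf p"
    using pmf_of_random_variable[OF assms(1) Wm] .
  have p: "size_bias_cx s lam p"
    by (rule size_bias_cx_of_s_cx_le[OF assms(3) Wm Wd assms(6) lam assms(11,14)])
  have q: "size_bias_cx s lam ?q" by (rule size_bias_cx_poisson[OF lam])
  have poly: "spline_mean p (Suc i) (int i - 1) \<le> spline_mean ?q (Suc i) (int i - 1)" if "i \<le> s" for i
  proof (rule spline_mean_start_le[OF p lam _ _ that])
    show "measure_pmf.expectation p real = lam"
      using assms(9) by (simp add: integral_random_variable[OF Wm Wd])
    show "measure_pmf.expectation p (\<lambda>x. real (x choose m))
        \<le> measure_pmf.expectation ?q (\<lambda>x. real (x choose m))" if "m \<in> {3..s}" for m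
      using assms(13)[OF that]
      by (simp only: integral_random_variable[OF Wm Wd, of "\<lambda>x. real (x choose m)"]
          integral_random_variable[OF Zm Zd, of "\<lambda>x. real (x choose m)"])
  qed
  have trunc: "spline_mean p (Suc s) (int (j + s)) \<le> spline_mean ?q (Suc s) (int (j + s))" for j
    using spline_mean_le[OF p q less_imp_le[OF lam] assms(12) spline_mean_poisson[OF lam] poly[OF order_refl], of "Suc j"]
    by (simp add: algebra_simps)
  have cdf: "\<P>(\<omega> in A. X \<omega> \<le> j) = 1 - spline_mean u 1 (int j)"
    if "X \<in> measurable A (count_space UNIV)" "distr A (count_space UNIV) X = measure_pmf u"
    for A :: "'d measure" and X u j
  proof -
    have "spline 1 (int j) = indicator {x. j < x}"
      by (auto simp: spline_1 fun_eq_iff indicator_def)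
    then have "spline_mean u 1 (int j) = measure_pmf.prob u {x. j < x}"
      by (simp add: spline_mean_def)
    also have "\<dots> = 1 - measure_pmf.prob u {x. x \<le> j}"
      by (subst measure_pmf.prob_compl[symmetric]) (auto intro!: arg_cong[where f = "measure_pmf.prob u"])
    finally show ?thesis using prob_random_variable[OF that, of "\<lambda>x. x \<le> j"] by simp
  qed
  \<comment> \<open>\<open>\<Delta>\<close> to the power \<open>-k\<close> turns order \<open>1\<close> into order \<open>k + 1\<close>; for \<open>k = -1\<close> this is the point mass.\<close>
  define r where "r = nat (k + 1)"
  have r: "r \<le> s + 2" using assms(17) by (auto simp: r_def)
  \<comment> \<open>\<open>1 - F j\<close> and \<open>1 - G j\<close> are spline means of order \<open>1\<close>, hence the sign.\<close>
  have FG: "F j - G j = - 1 * (spline_mean p 1 (int j) - spline_mean ?q 1 (int j))" for j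
    unfolding assms(15,16) cdf[OF Wm Wd] cdf[OF Zm Zd] by simp
  have diff: "\<bar>diff_pow (- k) (\<lambda>j. F j - G j) j\<bar> = \<bar>spline_mean p r (int j) - spline_mean ?q r (int j)\<bar>" for j
  proof (cases "k = - 1")
    case True
    then show ?thesis
      using spline_mean_pascal[OF p, of 0 "int j"] spline_mean_pascal[OF q, of 0 "int j"]
      unfolding FG diff_pow_def r_def by (simp add: fdiff_def algebra_simps abs_minus_commute)
  next
    case False
    then obtain n where k: "k = int n" "r = Suc n"
      using assms(17) by (intro that[of "nat k"]) (auto simp: r_def)
    have "diff_pow (- k) = inv_fdiff ^^ n"
      by (cases n) (simp_all add: diff_pow_def k(1) nat_add_distrib)
    then show ?thesis
      unfolding FG by (simp only: inv_fdiff_pow_spline_mean[OF p q]) (simp add: abs_mult k(2))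
  qed
  have binom: "(\<integral>\<omega>. real ((X \<omega> + s + 1) choose (s + 1)) \<partial>A) = spline_mean u (s + 2) (- 1)"
    if "X \<in> measurable A (count_space UNIV)" "distr A (count_space UNIV) X = measure_pmf u"
    for A :: "'d measure" and X u
  proof -
    have "real ((x + s + 1) choose (s + 1)) = spline (s + 2) (- 1) x" for x
      using binomial_add_eq_spline[of x "s + 1"] by (simp only: add.assoc) simp
    then show ?thesis
      unfolding spline_mean_def by (simp only: integral_random_variable[OF that])
  qed
  have exponent: "nat (max (int s - k - 1) 0) = s - r"
    using assms(17) by (auto simp: r_def)
  have bound: "\<bar>spline_mean p r (int j) - spline_mean ?q r (int j)\<bar>
      \<le> 2 ^ (s - r) * (spline_mean ?q (s + 2) (- 1) - spline_mean p (s + 2) (- 1))" for j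
    by (rule spline_mean_distance[OF p q]) (use poly trunc r in auto)
  show ?thesis
    unfolding d_inf_def sup_norm_def exponent binom[OF Wm Wd] binom[OF Zm Zd] diff
    by (intro SUP_least) (simp only: ereal_less_eq bound)
qed

end
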